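(* Let $A$ be an $n\times n$ matrix with all entries in $\{+1,-1\}$, and let $m$ be an integer with $2 \le m \le 6$. Define $n_0(2)=3$, $n_0(3)=5$, $n_0(4)=8$, $n_0(5)=15$, $n_0(6)=45$. If $n \ge n_0(m)$, then $A$ has a singular $m\times m$ submatrix.
   Context: An $m\times m$ submatrix of $A$ is obtained by choosing $m$ of the rows and $m$ of the columns of $A$ (not necessarily consecutive). Singular means having determinant zero. *)

theory Defs
  imports
    Complex_Main
    "Jordan_Normal_Form.Determinant"
    "Jordan_Normal_Form.DL_Submatrix"
begin

(* Only the values at 2,...,6 are meaningful. *)
definition n0 :: "nat \<Rightarrow> nat" where
  "n0 m = (if m = 2 then 3
           else if m = 3 then 5
           else if m = 4 then 8
           else if m = 5 then 15
           else if m = 6 then 45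
           else undefined)"

(* submatrix A I J keeps the rows with index in I and the columns with index in J, in increasing
   order, and silently ignores indices out of range; hence the explicit range conditions. *)
definition has_singular_submatrix :: "'a :: comm_ring_1 mat \<Rightarrow> nat \<Rightarrow> bool" where
  "has_singular_submatrix A m \<longleftrightarrow>
     (\<exists>I J. I \<subseteq> {..<dim_row A} \<and> card I = m \<and> J \<subseteq> {..<dim_col A} \<and> card J = m \<and>
            det (submatrix A I J) = 0)"

end

theory Submission
  imports Defs
begin

text \<open>Take any two rows. Their entrywise ratio takes only the values \<open>\<plusminus>1\<close>, so on at least \<open>m\<close> of
  \<open>2m - 1\<close> columns it is constant; on these columns the two rows are proportional. As
  \<open>n0 m \<ge> 2m - 1\<close>, any \<open>m\<close> rows containing these two yield a singular submatrix.\<close>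

lemma det_proportional_rows:
  fixes B :: "'a :: idom mat"
  assumes B: "B \<in> carrier_mat n n" and ij: "i < n" "j < n" "i \<noteq> j"
    and eq: "\<And>k. k < n \<Longrightarrow> B $$ (i, k) = c * B $$ (j, k)"
  shows "det B = 0"
proof -
  \<comment> \<open>Subtracting \<open>c\<close> times row \<open>j\<close> clears row
    \<open>i\<close> and keeps the determinant.\<close>
  let ?C = "addrow (- c) i j B"
  have C: "?C \<in> carrier_mat n n" using B by simp
  \<comment> \<open>Row \<open>i\<close> of \<open>?C\<close> is zero, so scaling it by 0 changes
    nothing, whereas it multiplies the determinant by 0.\<close>
  have "?C = multrow i 0 ?C"
    using B ij eq by (intro eq_matI) auto
  then have "det ?C = 0 * det ?C"
    using det_multrow[OF ij(1) C, of 0] by simp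
  then show ?thesis
    using det_addrow[OF ij(2,3) B, of "- c"] by simp
qed

lemma ex_constant_ratio:
  fixes f g :: "nat \<Rightarrow> real"
  assumes "\<And>j. j < n \<Longrightarrow> f j \<in> {1, -1}" "\<And>j. j < n \<Longrightarrow> g j \<in> {1, -1}" "2 * m - 1 \<le> n"
  obtains c J where "J \<subseteq> {..<n}" "card J = m" "\<And>j. j \<in> J \<Longrightarrow> f j = c * g j"
proof -
  let ?S = "\<lambda>c. {j \<in> {..<n}. f j = c * g j}"
  have "{..<n} \<subseteq> ?S 1 \<union> ?S (-1)" using assms(1,2) by fastforce
  then have "n \<le> card (?S 1 \<union> ?S (-1))" using card_mono[of "?S 1 \<union> ?S (-1)" "{..<n}"] by simp
  also have "\<dots> \<le> card (?S 1) + card (?S (-1))" by (rule card_Un_le)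
  \<comment> \<open>Pigeonhole: two classes of at most \<open>m - 1\<close> columns each would cover
    at most \<open>2 * m - 2\<close> columns.\<close>
  finally have "m \<le> card (?S 1) \<or> m \<le> card (?S (-1))" using assms(3) by linarith
  then obtain c where "m \<le> card (?S c)" by blast
  then obtain J where "J \<subseteq> ?S c" "card J = m" by (meson obtain_subset_with_card_n)
  then show thesis by (intro that[of J c]) auto
qed

text \<open>An initial segment has no gaps, so exactly \<open>i\<close> of its elements lie below
  \<open>i\<close>. Hence rows chosen by \<open>{..<m}\<close> keep their indices in the
  submatrix.\<close>

lemma pick_lessThan:
  assumes "i < m"
  shows "pick {..<m} i = i"
proof -
  have "{a \<in> {..<m}. a < i} = {..<i}" using assms by auto
  then show ?thesis using pick_card_in_set[of i "{..<m}"] assms by simp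
qed

lemma has_singular_submatrix_sign_mat:
  fixes A :: "real mat"
  assumes A: "A \<in> carrier_mat n n"
    and sign: "\<And>i j. i < n \<Longrightarrow> j < n \<Longrightarrow> A $$ (i, j) \<in> {1, -1}"
    and m: "2 \<le> m" "2 * m - 1 \<le> n"
  shows "has_singular_submatrix A m"
proof -
  have n: "0 < n" "1 < n" "m \<le> n" using m by auto
  \<comment> \<open>Rows 0 and 1 serve as the two rows; both lie in \<open>{..<m}\<close> because
    \<open>2 \<le> m\<close>.\<close>
  obtain c J where J: "J \<subseteq> {..<n}" "card J = m"
    and c: "\<And>j. j \<in> J \<Longrightarrow> A $$ (0, j) = c * A $$ (1, j)"
    using ex_constant_ratio[of n "\<lambda>j. A $$ (0, j)" "\<lambda>j. A $$ (1, j)" m] sign n m by metis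
  \<comment> \<open>All chosen indices are in range, so \<open>submatrix\<close> drops none and
    \<open>?B\<close> really is \<open>m\<close> by \<open>m\<close>.\<close>
  have rows: "{i. i < dim_row A \<and> i \<in> {..<m}} = {..<m}" and cols: "{j. j < dim_col A \<and> j \<in> J} = J"
    using A J n by auto
  let ?B = "submatrix A {..<m} J"
  have B: "?B \<in> carrier_mat m m"
    using dim_submatrix[of A "{..<m}" J] unfolding rows cols J(2) by auto
  have entry: "?B $$ (i, k) = A $$ (i, pick J k)" if "i < m" "k < m" for i k
    using submatrix_index[of i A "{..<m}" k J] that unfolding rows cols J(2)
    by (simp add: pick_lessThan)
  have "det ?B = 0"
  proof (rule det_proportional_rows[OF B, of 0 1])
    show "?B $$ (0, k) = c * ?B $$ (1, k)" if "k < m" for k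
      using entry[of 0 k] entry[of 1 k] that m c[OF pick_in_set_le] J(2) by simp
  qed (use m in auto)
  then show ?thesis
    unfolding has_singular_submatrix_def using A J n
    by (intro exI[of _ "{..<m}"] exI[of _ J]) auto
qed

theorem corollary3:
  fixes A :: "real mat" and n m :: nat
  assumes "A \<in> carrier_mat n n"
    and "\<And>i j. i < n \<Longrightarrow> j < n \<Longrightarrow> A $$ (i, j) \<in> {1, -1}"
    and "2 \<le> m" and "m \<le> 6"
    and "n \<ge> n0 m"
  shows "has_singular_submatrix A m"
proof (rule has_singular_submatrix_sign_mat[OF assms(1-3)])
  have "m \<in> {2, 3, 4, 5, 6}" using assms(3,4) by auto
  \<comment> \<open>Case by case: 3, 5, 7, 9, 11 against the thresholds 3, 5, 8, 15, 45.\<close>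
  then show "2 * m - 1 \<le> n" using assms(5) by (auto simp: n0_def)
qed

end
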